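(* Let $t\neq 0$, and let $F_n^{(a)}(q)$ ($n\ge 0$) be the $q$-Fibonacci numbers with parameter $a$. For every integer $n\ge 0$, $$\sum_{k=0}^n \frac{(-1)^k}{t^k}\, q^{-ak}q^{-\binom{k+1}{2}} \left( F^{(a)}_{k+2}(q) +(t-1)q^{a+k}F^{(a)}_{k}(q) \right) = \frac{(-1)^n}{t^n}q^{-na}q^{-\binom{n+1}{2}}F^{(a)}_{n+1}(q).$$
   Context: The $q$-Fibonacci numbers with parameter $a$ are defined by $F_0^{(a)}(q)=0$, $F_1^{(a)}(q)=1$, and $F_{n+2}^{(a)}(q) = F_{n+1}^{(a)}(q) + q^{a+n} F_n^{(a)}(q)$ for $n\ge 0$. Here $q$ is a nonzero complex number (or an indeterminate), $q^{a+m}$ means $q^a\cdot q^m$ for a fixed nonzero value $q^a$, and $q^{-ak}=(q^a)^{-k}$. $t$ is an indeterminate, which may be specialized to any nonzero complex number. *)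

theory Defs
  imports Complex_Main
begin

text \<open>The parameter \<open>a\<close> enters only through a fixed nonzero value \<open>q\<^sup>a\<close>, which is
  the argument \<open>qa\<close>; accordingly \<open>q\<^sup>a\<^sup>+\<^sup>m\<close> is \<open>qa * q ^ m\<close>. Over an arbitrary field,
  \<open>q\<close> and \<open>qa\<close> may be complex numbers or indeterminates (in a field of rational functions).\<close>

fun qfib :: "'a::field \<Rightarrow> 'a \<Rightarrow> nat \<Rightarrow> 'a" where
  "qfib q qa 0 = 0"
| "qfib q qa (Suc 0) = 1"
| "qfib q qa (Suc (Suc n)) = qfib q qa (Suc n) + qa * q ^ n * qfib q qa n"

end

theory Submission
  imports Defs
begin

text \<open>By the recurrence the \<open>k\<close>-th bracket is \<open>F\<^sub>k\<^sub>+\<^sub>1 + t q\<^sup>a\<^sup>+\<^sup>k F\<^sub>k\<close>. The signed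
  coefficients \<open>c\<^sub>k\<close> satisfy \<open>t q\<^sup>a\<^sup>+\<^sup>k c\<^sub>k = - c\<^sub>k\<^sub>-\<^sub>1\<close>, so the \<open>k\<close>-th summand is
  \<open>c\<^sub>k F\<^sub>k\<^sub>+\<^sub>1 - c\<^sub>k\<^sub>-\<^sub>1 F\<^sub>k\<close> and the sum telescopes.\<close>

theorem mainTheorem11:
  fixes q qa t :: "'a::field" and n :: nat
  assumes "q \<noteq> 0" and "qa \<noteq> 0" and "t \<noteq> 0"
  shows "(\<Sum>k=0..n. (-1) ^ k / t ^ k * qa powi (- int k) * q powi (- int ((k + 1) choose 2))
            * (qfib q qa (k + 2) + (t - 1) * (qa * q ^ k) * qfib q qa k))
         = (-1) ^ n / t ^ n * qa powi (- int n) * q powi (- int ((n + 1) choose 2))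
            * qfib q qa (n + 1)"
proof -
  define c where "c k = (-1) ^ k / t ^ k * qa powi (- int k) * q powi (- int ((k + 1) choose 2))" for k
  have c_Suc: "t * (qa * q ^ Suc k) * c (Suc k) = - c k" for k
  proof -
    \<comment> \<open>Pascal's rule: from \<open>k\<close> to \<open>Suc k\<close> the power of
      \<open>q\<close> in \<open>c\<close> gains exactly the factor
      \<open>q powi (- int (Suc k))\<close>, which \<open>q ^ Suc k\<close> cancels.\<close>
    have binom: "(Suc k + 1) choose 2 = ((k + 1) choose 2) + Suc k"
      by (simp add: numeral_2_eq_2)
    show ?thesis
      unfolding c_def binom power_int_minus power_int_of_nat power_add
      using assms by (simp add: field_simps)
  qed
  have "(\<Sum>k=0..n. c k * (qfib q qa (k + 2) + (t - 1) * (qa * q ^ k) * qfib q qa k))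
      = c n * qfib q qa (n + 1)"
  proof (induction n)
    case 0
    \<comment> \<open>No coefficient precedes \<open>c 0\<close>; the term it would carry vanishes
      because \<open>qfib q qa 0 = 0\<close>.\<close>
    show ?case by (simp add: numeral_2_eq_2)
  next
    case (Suc n)
    have "c (Suc n) * (qfib q qa (Suc n + 2) + (t - 1) * (qa * q ^ Suc n) * qfib q qa (Suc n))
        = c (Suc n) * qfib q qa (n + 2) + t * (qa * q ^ Suc n) * c (Suc n) * qfib q qa (Suc n)"
      by (simp add: algebra_simps)
    \<comment> \<open>By \<open>c_Suc\<close> the last product is
      \<open>- c n * qfib q qa (Suc n)\<close>, which cancels the partial sum given by the induction
      hypothesis.\<close>
    then show ?case
      using Suc unfolding c_Suc by simp
  qed
  then show ?thesis
    by (simp only: c_def)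
qed

end
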